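(* Let $d\ge 1$, $k\ge 1$ be integers and let $c^2>0$, $b_1,\dots,b_k>0$ pairwise distinct, and $a_1,\dots,a_k\in\mathbb{R}\setminus\{0\}$ be constants. Then the matrix $A(\xi)$ (defined in the context) is uniformly diagonalizable with real eigenvalues: for every $\xi\in\mathbb{R}^d$ there exists an invertible matrix $P(\xi)$ such that $P(\xi)A(\xi)P^{-1}(\xi)$ is diagonal and real, and $$\sup_{\xi\in\mathbb{S}^{d-1}}\left\Vert P^{-1}(\xi)\right\Vert\left\Vert P(\xi)\right\Vert<\infty .$$
   Context: Set $n=kd+d+1$. Vectors are written in block form $(u,v,w_1,\dots,w_k)$ with $u$ scalar and $v,w_1,\dots,w_k$ having $d$ components. For $\xi=(\xi_1,\dots,\xi_d)\in\mathbb{R}^d$ (column vector), $A(\xi)=\sum_{j=1}^d\xi_jA_j$ is the real $n\times n$ matrix $$A(\xi)=\begin{pmatrix}0&\xi^T&0&\cdots&0\\ c^2\xi&0&0&\cdots&0\\ -a_1\xi&0&0&\cdots&0\\ \vdots&\vdots&\vdots&&\vdots\\ -a_k\xi&0&0&\cdots&0\end{pmatrix},$$ i.e. $A(\xi)(u,v,w_1,\dots,w_k)=(\xi\cdot v,\;c^2\xi u,\;-a_1\xi u,\dots,-a_k\xi u)$. The matrix norm is $\|M\|=\sup_{|x|=1}|Mx|$, induced by the Euclidean norm. $\mathbb{S}^{d-1}$ is the unit sphere of $\mathbb{R}^d$. *)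

theory Defs
  imports "HOL-Analysis.Analysis"
begin

text \<open>Index type of the block vectors \<open>(u, v, w\<^sub>1, \<dots>, w\<^sub>k)\<close>: \<open>Inl ()\<close> is the scalar \<open>u\<close>,
  \<open>Inr (Inl l)\<close> is the \<open>l\<close>-th component of \<open>v\<close>, and \<open>Inr (Inr (i, l))\<close> is the \<open>l\<close>-th component
  of \<open>w\<^sub>i\<close>. With \<open>d = CARD('d)\<close> and \<open>k = CARD('k)\<close> its cardinality is \<open>n = k d + d + 1\<close>.\<close>

type_synonym ('k, 'd) block_index = "unit + 'd + 'k \<times> 'd"

definition A_entry ::
  "real \<Rightarrow> ('k \<Rightarrow> real) \<Rightarrow> real^'d \<Rightarrow> ('k, 'd) block_index \<Rightarrow> ('k, 'd) block_index \<Rightarrow> real" where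
  "A_entry c a \<xi> r s =
    (case (r, s) of
      (Inl _, Inr (Inl l)) \<Rightarrow> \<xi> $ l
    | (Inr (Inl l), Inl _) \<Rightarrow> c\<^sup>2 * \<xi> $ l
    | (Inr (Inr (i, l)), Inl _) \<Rightarrow> - a i * \<xi> $ l
    | _ \<Rightarrow> 0)"

definition A_matrix ::
  "real \<Rightarrow> ('k::finite \<Rightarrow> real) \<Rightarrow> real^'d \<Rightarrow> real^('k, 'd) block_index^('k, 'd) block_index" where
  "A_matrix c a \<xi> = (\<chi> r s. A_entry c a \<xi> r s)"

definition diagonal_matrix :: "real^'n^'n \<Rightarrow> bool" where
  "diagonal_matrix M \<longleftrightarrow> (\<forall>i j. i \<noteq> j \<longrightarrow> M $ i $ j = 0)"

definition matrix_norm :: "real^'n^'m \<Rightarrow> real" where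
  "matrix_norm M = (SUP x\<in>sphere 0 1. norm (M *v x))"

end

theory Submission
  imports Defs
begin

text \<open>
  The operator \<open>A(\<xi>)\<close> acts on block vectors by
  \<open>(u, v, w\<^sub>i) \<mapsto> (\<xi> \<bullet> v, c\<^sup>2 u \<xi>, - a\<^sub>i u \<xi>)\<close>, a formula built only from inner products and scalar
  multiples, so it is equivariant under orthogonal maps of \<open>\<real>\<^sup>d\<close>. Let \<open>e = axis j 1\<close> be a fixed
  coordinate vector and \<open>H\<close> an orthogonal map with \<open>H \<xi> = \<bar>\<xi>\<bar> e\<close>. The map \<open>R\<close> that applies \<open>H\<close> to
  \<open>v\<close> and to every \<open>w\<^sub>i\<close> is then orthogonal and satisfies \<open>R A(\<xi>) = \<bar>\<xi>\<bar> A(e) R\<close>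
  (\<open>rotate_blocks_A_matrix\<close>).

  It remains to diagonalize the single matrix \<open>A(e)\<close>. The quantities \<open>c u + v\<^sub>j\<close> and
  \<open>c u - v\<^sub>j\<close> are multiplied by \<open>c\<close> and \<open>-c\<close>, while \<open>w\<^sub>i + (a\<^sub>i / c\<^sup>2) v\<close> and the \<open>v\<^sub>l\<close> with
  \<open>l \<noteq> j\<close> are sent to \<open>0\<close>; since \<open>c \<noteq> 0\<close> they form a complete system of coordinates
  (\<open>eigencoords_A_matrix\<close>, \<open>invertible_eigencoords\<close>). If \<open>P\<^sub>0\<close> is the matrix of these coordinates,
  \<open>P(\<xi>) = P\<^sub>0 R\<close> diagonalizes \<open>A(\<xi>)\<close>.

  Orthogonal factors do not change the operator norm, so
  \<open>\<parallel>P(\<xi>)\<^sup>-\<^sup>1\<parallel> \<parallel>P(\<xi>)\<parallel> = \<parallel>P\<^sub>0\<^sup>-\<^sup>1\<parallel> \<parallel>P\<^sub>0\<parallel>\<close> for every \<open>\<xi>\<close>, and the supremum is that of a constant.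
\<close>

section \<open>Block vectors\<close>

type_synonym ('k, 'd) block_vec = "real^('k, 'd) block_index"

definition u_part :: "('k::finite, 'd::finite) block_vec \<Rightarrow> real" where
  "u_part x = x $ Inl ()"

definition v_part :: "('k::finite, 'd::finite) block_vec \<Rightarrow> real^'d" where
  "v_part x = (\<chi> l. x $ Inr (Inl l))"

definition w_part :: "('k::finite, 'd::finite) block_vec \<Rightarrow> 'k \<Rightarrow> real^'d" where
  "w_part x i = (\<chi> l. x $ Inr (Inr (i, l)))"

definition block :: "real \<Rightarrow> real^'d \<Rightarrow> ('k \<Rightarrow> real^'d) \<Rightarrow> ('k::finite, 'd::finite) block_vec" where
  "block u v w =
    (\<chi> r. case r of Inl _ \<Rightarrow> u | Inr (Inl l) \<Rightarrow> v $ l | Inr (Inr (i, l)) \<Rightarrow> w i $ l)"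

lemma parts_block [simp]:
  "u_part (block u v w) = u" "v_part (block u v w) = v" "w_part (block u v w) = w"
  by (simp_all add: u_part_def v_part_def w_part_def block_def vec_eq_iff fun_eq_iff)

lemma parts_add [simp]:
  "u_part (x + y) = u_part x + u_part y"
  "v_part (x + y) = v_part x + v_part y"
  "w_part (x + y) i = w_part x i + w_part y i"
  by (simp_all add: u_part_def v_part_def w_part_def vec_eq_iff)

lemma parts_scaleR [simp]:
  "u_part (t *\<^sub>R x) = t * u_part x"
  "v_part (t *\<^sub>R x) = t *\<^sub>R v_part x"
  "w_part (t *\<^sub>R x) i = t *\<^sub>R w_part x i"
  by (simp_all add: u_part_def v_part_def w_part_def vec_eq_iff)

lemma parts_zero [simp]: "u_part 0 = 0" "v_part 0 = 0" "w_part 0 i = 0"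
  by (simp_all add: u_part_def v_part_def w_part_def vec_eq_iff)

lemma block_vec_eqI:
  assumes "u_part x = u_part y" "v_part x = v_part y" "\<And>i. w_part x i = w_part y i"
  shows "x = y"
proof -
  have "x $ r = y $ r" for r
  proof -
    consider "r = Inl ()" | l where "r = Inr (Inl l)" | i l where "r = Inr (Inr (i, l))"
      by (metis (mono_tags) old.unit.exhaust sumE surj_pair)
    then show ?thesis
      using assms by cases (simp_all add: u_part_def v_part_def w_part_def vec_eq_iff)
  qed
  then show ?thesis by (simp add: vec_eq_iff)
qed

lemma sum_UNIV_sum_type:
  fixes f :: "'a::finite + 'b::finite \<Rightarrow> real"
  shows "sum f UNIV = (\<Sum>x\<in>UNIV. f (Inl x)) + (\<Sum>y\<in>UNIV. f (Inr y))"
  using sum.Plus[of UNIV UNIV f] by (simp add: comp_def)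

lemma sum_block_index:
  fixes f :: "('k::finite, 'd::finite) block_index \<Rightarrow> real"
  shows "sum f UNIV =
    f (Inl ()) + (\<Sum>l\<in>UNIV. f (Inr (Inl l))) + (\<Sum>i\<in>UNIV. \<Sum>l\<in>UNIV. f (Inr (Inr (i, l))))"
  by (simp add: sum_UNIV_sum_type UNIV_unit sum.cartesian_product)

lemma inner_block_vec:
  "x \<bullet> y = u_part x * u_part y + v_part x \<bullet> v_part y + (\<Sum>i\<in>UNIV. w_part x i \<bullet> w_part y i)"
  by (simp add: inner_vec_def sum_block_index u_part_def v_part_def w_part_def)

lemma A_matrix_mult_vec:
  "A_matrix c a \<xi> *v x =
    block (\<xi> \<bullet> v_part x) ((c\<^sup>2 * u_part x) *\<^sub>R \<xi>) (\<lambda>i. (- a i * u_part x) *\<^sub>R \<xi>)"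
  by (rule block_vec_eqI)
    (simp_all add: A_matrix_def A_entry_def matrix_vector_mult_def sum_block_index inner_vec_def
      u_part_def v_part_def w_part_def block_def vec_eq_iff)

section \<open>Rotating the symbol to a coordinate direction\<close>

definition rotate_blocks ::
    "(real^'d \<Rightarrow> real^'d) \<Rightarrow> ('k::finite, 'd::finite) block_vec \<Rightarrow> ('k, 'd) block_vec" where
  "rotate_blocks H x = block (u_part x) (H (v_part x)) (\<lambda>i. H (w_part x i))"

lemma orthogonal_transformation_rotate_blocks:
  fixes H :: "real^'d \<Rightarrow> real^'d"
  assumes "orthogonal_transformation H"
  shows "orthogonal_transformation
    (rotate_blocks H :: ('k::finite, 'd::finite) block_vec \<Rightarrow> _)"
  unfolding orthogonal_transformation_def
proof (intro conjI allI)
  have lin: "linear H" using assms by (simp add: orthogonal_transformation_def)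
  show "linear (rotate_blocks H :: ('k, 'd) block_vec \<Rightarrow> _)"
    by (rule linearI; rule block_vec_eqI)
      (simp_all add: rotate_blocks_def linear_add[OF lin] linear_cmul[OF lin])
  show "rotate_blocks H x \<bullet> rotate_blocks H y = x \<bullet> y"
    for x y :: "('k, 'd) block_vec"
    using assms by (simp add: rotate_blocks_def inner_block_vec orthogonal_transformation_def)
qed

text \<open>In the scalar block the equality is \<open>\<xi> \<bullet> v = H \<xi> \<bullet> H v\<close>; in the other blocks only
  \<open>H \<xi> = t e\<close> enters.\<close>

lemma rotate_blocks_A_matrix:
  assumes H: "orthogonal_transformation H" and e: "H \<xi> = t *\<^sub>R e"
  shows "rotate_blocks H (A_matrix c a \<xi> *v x) = t *\<^sub>R (A_matrix c a e *v rotate_blocks H x)"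
proof (rule block_vec_eqI)
  have lin: "linear H" using H by (simp add: orthogonal_transformation_def)
  have "\<xi> \<bullet> v_part x = H \<xi> \<bullet> H (v_part x)"
    using H by (simp add: orthogonal_transformation_def)
  then show "u_part (rotate_blocks H (A_matrix c a \<xi> *v x)) =
      u_part (t *\<^sub>R (A_matrix c a e *v rotate_blocks H x))"
    by (simp add: rotate_blocks_def A_matrix_mult_vec e)
  show "v_part (rotate_blocks H (A_matrix c a \<xi> *v x)) =
      v_part (t *\<^sub>R (A_matrix c a e *v rotate_blocks H x))"
    by (simp add: rotate_blocks_def A_matrix_mult_vec linear_cmul[OF lin] e mult_ac)
  show "w_part (rotate_blocks H (A_matrix c a \<xi> *v x)) i =
      w_part (t *\<^sub>R (A_matrix c a e *v rotate_blocks H x)) i" for i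
    using linear_cmul[OF lin, of "- (a i * u_part x)" \<xi>]
    by (simp add: rotate_blocks_def A_matrix_mult_vec e mult_ac)
qed

section \<open>Diagonalization in a coordinate direction\<close>

text \<open>For \<open>c \<noteq> 0\<close> every entry of this vector is a left eigenfunctional of \<open>A(axis j 1)\<close>. The term
  with \<open>axis j 1\<close> replaces \<open>v\<^sub>j\<close> by \<open>c u - v\<^sub>j\<close> and keeps the other components of \<open>v\<close>; the
  shift by \<open>(a\<^sub>i / c\<^sup>2) v\<close> cancels the image \<open>- a\<^sub>i u \<xi>\<close> in \<open>w\<^sub>i\<close> against \<open>c\<^sup>2 u \<xi>\<close> in \<open>v\<close>.\<close>

definition eigencoords ::
    "real \<Rightarrow> ('k \<Rightarrow> real) \<Rightarrow> 'd \<Rightarrow> ('k::finite, 'd::finite) block_vec \<Rightarrow> ('k, 'd) block_vec" where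
  "eigencoords c a j x =
    block (c * u_part x + v_part x $ j)
      (v_part x + (c * u_part x - 2 * v_part x $ j) *\<^sub>R axis j 1)
      (\<lambda>i. w_part x i + (a i / c\<^sup>2) *\<^sub>R v_part x)"

definition eigenvalues :: "real \<Rightarrow> 'd \<Rightarrow> ('k::finite, 'd::finite) block_vec" where
  "eigenvalues c j = block c (axis j (- c)) (\<lambda>_. 0)"

definition diag :: "real^'n \<Rightarrow> real^'n^'n" where
  "diag q = (\<chi> r s. if r = s then q $ r else 0)"

lemma diag_mult_vec: "diag q *v x = (\<chi> r. q $ r * x $ r)"
  by (simp add: diag_def matrix_vector_mult_def mult_delta_left)

lemma linear_eigencoords: "linear (eigencoords c a j)"
  by (rule linearI; rule block_vec_eqI)
    (simp_all add: eigencoords_def vec_eq_iff algebra_simps axis_def)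

lemma eigencoords_A_matrix:
  assumes "c \<noteq> 0"
  shows "eigencoords c a j (A_matrix c a (axis j 1) *v x) =
    diag (eigenvalues c j) *v eigencoords c a j x"
proof -
  have parts: "u_part (\<chi> r. q $ r * y $ r) = u_part q * u_part y"
    "v_part (\<chi> r. q $ r * y $ r) = (\<chi> l. v_part q $ l * v_part y $ l)"
    "w_part (\<chi> r. q $ r * y $ r) i = (\<chi> l. w_part q i $ l * w_part y i $ l)"
    for q y :: "('k::finite, 'd::finite) block_vec" and i
    by (simp_all add: u_part_def v_part_def w_part_def vec_eq_iff)
  have axis: "axis j z $ l = (if l = j then z else 0)" for z :: real and l
    by (simp add: axis_def)
  show ?thesis
    using assms
    by (intro block_vec_eqI)
      (simp_all add: eigencoords_def eigenvalues_def A_matrix_mult_vec diag_mult_vec parts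
        inner_axis' axis vec_eq_iff algebra_simps power2_eq_square)
qed

text \<open>The coordinates \<open>c u + v\<^sub>j\<close> and \<open>c u - v\<^sub>j\<close> determine \<open>u\<close> and \<open>v\<^sub>j\<close>; then \<open>v\<close> is known, and
  with it the shift in each \<open>w\<^sub>i\<close>.\<close>

lemma invertible_eigencoords:
  assumes "c \<noteq> 0"
  shows "invertible (matrix (eigencoords c a j))"
proof -
  have "\<forall>x. matrix (eigencoords c a j) *v x = 0 \<longrightarrow> x = 0"
  proof (intro allI impI)
    fix x
    assume "matrix (eigencoords c a j) *v x = 0"
    then have "eigencoords c a j x = 0" by (simp add: matrix_works linear_eigencoords)
    then have "u_part (eigencoords c a j x) = 0" "v_part (eigencoords c a j x) = 0"
      and w: "w_part (eigencoords c a j x) i = 0" for i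
      by (simp_all only: parts_zero)
    then have u: "c * u_part x + v_part x $ j = 0"
      and v: "v_part x + (c * u_part x - 2 * v_part x $ j) *\<^sub>R axis j 1 = 0"
      by (simp_all add: eigencoords_def)
    from v have "(v_part x + (c * u_part x - 2 * v_part x $ j) *\<^sub>R axis j 1) $ j = 0"
      by simp
    then have "c * u_part x - v_part x $ j = 0" by (simp add: axis_def)
    with u have "v_part x $ j = 0" and "c * u_part x = 0" by linarith+
    with v have "v_part x = 0" by simp
    moreover have "u_part x = 0" using assms \<open>c * u_part x = 0\<close> by simp
    ultimately show "x = 0" using w by (intro block_vec_eqI) (simp_all add: eigencoords_def)
  qed
  then show ?thesis
    unfolding invertible_left_inverse matrix_left_invertible_ker .
qed

section \<open>Operator norms and orthogonal factors\<close>

lemma matrix_inv_eqI: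
  fixes A B :: "real^'n^'n"
  assumes "A ** B = mat 1"
  shows "matrix_inv A = B"
proof -
  have "B ** A = mat 1" using assms matrix_left_right_inverse by blast
  then have "A ** matrix_inv A = mat 1 \<and> matrix_inv A ** A = mat 1"
    unfolding matrix_inv_def
    using assms someI[of "\<lambda>C. A ** C = mat 1 \<and> C ** A = mat 1" B] by blast
  then have "(matrix_inv A ** A) ** B = B" by simp
  then show ?thesis using assms by (simp add: matrix_mul_assoc[symmetric])
qed

lemma matrix_inv_right_inverse:
  fixes A :: "real^'n^'n"
  assumes "invertible A"
  shows "A ** matrix_inv A = mat 1"
  using assms matrix_inv_eqI by (auto simp: invertible_right_inverse)

lemma matrix_inv_mult_orthogonal:
  fixes P R :: "real^'n^'n"
  assumes "invertible P" "orthogonal_matrix R"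
  shows "matrix_inv (P ** R) = transpose R ** matrix_inv P"
proof (rule matrix_inv_eqI)
  have "P ** R ** (transpose R ** matrix_inv P) = P ** (R ** transpose R) ** matrix_inv P"
    by (simp only: matrix_mul_assoc)
  also have "\<dots> = mat 1"
    using assms by (simp add: orthogonal_matrix_def matrix_inv_right_inverse)
  finally show "P ** R ** (transpose R ** matrix_inv P) = mat 1" .
qed

lemma matrix_norm_orthogonal_left:
  fixes R :: "real^'n^'n" and M :: "real^'m^'n"
  assumes "orthogonal_matrix R"
  shows "matrix_norm (R ** M) = matrix_norm M"
proof -
  have "orthogonal_transformation ((*v) R)"
    using assms by (simp add: orthogonal_transformation_matrix)
  then have "norm ((R ** M) *v x) = norm (M *v x)" for x
    by (simp add: matrix_vector_mul_assoc[symmetric] orthogonal_transformation_norm)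
  then show ?thesis by (simp add: matrix_norm_def)
qed

text \<open>An orthogonal matrix permutes the unit sphere over which the supremum is taken.\<close>

lemma matrix_norm_orthogonal_right:
  fixes R :: "real^'n^'n" and M :: "real^'n^'m"
  assumes "orthogonal_matrix R"
  shows "matrix_norm (M ** R) = matrix_norm M"
proof -
  have R: "orthogonal_transformation ((*v) R)"
    using assms by (simp add: orthogonal_transformation_matrix)
  have "(*v) R ` sphere 0 1 = (*v) R ` cball 0 1 - (*v) R ` ball 0 1"
    by (simp add: image_set_diff[OF orthogonal_transformation_inj[OF R], symmetric]
        cball_diff_eq_sphere)
  also have "\<dots> = sphere 0 1"
    by (simp add: image_orthogonal_transformation_cball[OF R]
        image_orthogonal_transformation_ball[OF R] cball_diff_eq_sphere)
  finally have "(*v) R ` sphere 0 1 = sphere 0 1" .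
  then have "(\<lambda>x. norm (M *v x)) ` sphere 0 1 = (\<lambda>x. norm (M *v x)) ` (*v) R ` sphere 0 1"
    by simp
  also have "\<dots> = (\<lambda>x. norm ((M ** R) *v x)) ` sphere 0 1"
    by (simp add: image_image matrix_vector_mul_assoc)
  finally show ?thesis by (simp add: matrix_norm_def)
qed

text \<open>Right multiplication by an orthogonal matrix multiplies the inverse by an orthogonal matrix on
  the left, so neither factor of the condition number changes.\<close>

lemma condition_number_orthogonal_right:
  fixes P R :: "real^'n^'n"
  assumes "invertible P" "orthogonal_matrix R"
  shows "matrix_norm (matrix_inv (P ** R)) * matrix_norm (P ** R) =
    matrix_norm (matrix_inv P) * matrix_norm P"
  using assms
  by (simp add: matrix_inv_mult_orthogonal matrix_norm_orthogonal_left matrix_norm_orthogonal_right)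

section \<open>Uniform diagonalizability\<close>

theorem proposition3p1:
  fixes c :: real
    and a b :: "'k::finite \<Rightarrow> real"
  assumes "c\<^sup>2 > 0"
    and "\<And>i. b i > 0"
    and "inj b"
    and "\<And>i. a i \<noteq> 0"
  shows "\<exists>P :: real^'d::finite \<Rightarrow> real^('k, 'd) block_index^('k, 'd) block_index.
    (\<forall>\<xi>. invertible (P \<xi>) \<and>
         diagonal_matrix (P \<xi> ** A_matrix c a \<xi> ** matrix_inv (P \<xi>))) \<and>
    (SUP \<xi>\<in>sphere 0 1. ereal (matrix_norm (matrix_inv (P \<xi>)) * matrix_norm (P \<xi>))) < \<infinity>"
proof -
  have c: "c \<noteq> 0" using assms(1) by auto
  fix j :: 'd
  let ?e = "axis j 1 :: real^'d"
  define D :: "real^('k, 'd) block_index^('k, 'd) block_index" where "D = diag (eigenvalues c j)"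
  define P0 :: "real^('k, 'd) block_index^('k, 'd) block_index"
    where "P0 = matrix (eigencoords c a j)"
  have P0_vec: "P0 *v x = eigencoords c a j x" for x
    by (simp add: P0_def matrix_works linear_eigencoords)
  have P0_inv: "invertible P0"
    using c by (simp add: P0_def invertible_eigencoords)
  have "\<forall>\<xi>::real^'d. \<exists>H. orthogonal_transformation H \<and> H \<xi> = norm \<xi> *\<^sub>R ?e"
  proof
    fix \<xi> :: "real^'d"
    have "norm \<xi> = norm (norm \<xi> *\<^sub>R ?e)" by simp
    then show "\<exists>H. orthogonal_transformation H \<and> H \<xi> = norm \<xi> *\<^sub>R ?e"
      by (rule orthogonal_transformation_exists) blast
  qed
  then obtain H :: "real^'d \<Rightarrow> real^'d \<Rightarrow> real^'d"
    where H: "\<And>\<xi>. orthogonal_transformation (H \<xi>)"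
      and H_e: "\<And>\<xi>. H \<xi> \<xi> = norm \<xi> *\<^sub>R ?e"
    by metis
  define R :: "real^'d \<Rightarrow> real^('k, 'd) block_index^('k, 'd) block_index"
    where "R \<xi> = matrix (rotate_blocks (H \<xi>))" for \<xi>
  have rot: "orthogonal_transformation (rotate_blocks (H \<xi>) :: ('k, 'd) block_vec \<Rightarrow> _)" for \<xi>
    by (rule orthogonal_transformation_rotate_blocks[OF H])
  have R_orth: "orthogonal_matrix (R \<xi>)" for \<xi>
    using rot[of \<xi>]
    by (simp add: R_def orthogonal_transformation_matrix)
  have R_vec: "R \<xi> *v x = rotate_blocks (H \<xi>) x" for \<xi> x
    using rot[of \<xi>]
    by (simp add: R_def matrix_works orthogonal_transformation_def)
  have R_inv: "invertible (R \<xi>)" for \<xi>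
    using R_orth[of \<xi>] unfolding orthogonal_matrix_def invertible_def by blast
  define P where "P \<xi> = P0 ** R \<xi>" for \<xi>
  have P_inv: "invertible (P \<xi>)" for \<xi>
    by (simp add: P_def invertible_mult P0_inv R_inv)
  have PA: "P \<xi> ** A_matrix c a \<xi> = norm \<xi> *\<^sub>R D ** P \<xi>" for \<xi>
  proof -
    have "(P \<xi> ** A_matrix c a \<xi>) *v x = (norm \<xi> *\<^sub>R D ** P \<xi>) *v x" for x
    proof -
      have "(P \<xi> ** A_matrix c a \<xi>) *v x =
          eigencoords c a j (rotate_blocks (H \<xi>) (A_matrix c a \<xi> *v x))"
        by (simp add: P_def matrix_vector_mul_assoc[symmetric] P0_vec R_vec)
      also have "\<dots> = norm \<xi> *\<^sub>R eigencoords c a j (A_matrix c a ?e *v rotate_blocks (H \<xi>) x)"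
        by (simp add: rotate_blocks_A_matrix[OF H H_e] linear_cmul[OF linear_eigencoords])
      also have "\<dots> = norm \<xi> *\<^sub>R (D *v (P \<xi> *v x))"
        using c by (simp add: eigencoords_A_matrix D_def P_def matrix_vector_mul_assoc[symmetric]
            P0_vec R_vec)
      also have "\<dots> = (norm \<xi> *\<^sub>R D ** P \<xi>) *v x"
        by (simp only: scaleR_matrix_vector_assoc matrix_vector_mul_assoc scalar_matrix_assoc)
      finally show ?thesis .
    qed
    then show ?thesis by (simp add: matrix_eq)
  qed
  have "P \<xi> ** A_matrix c a \<xi> ** matrix_inv (P \<xi>) = norm \<xi> *\<^sub>R D" for \<xi>
    unfolding PA matrix_mul_assoc[symmetric] matrix_inv_right_inverse[OF P_inv] by simp
  then have P_diag: "diagonal_matrix (P \<xi> ** A_matrix c a \<xi> ** matrix_inv (P \<xi>))" for \<xi>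
    by (simp add: diagonal_matrix_def D_def diag_def)
  have "(SUP \<xi>\<in>sphere 0 1. ereal (matrix_norm (matrix_inv (P \<xi>)) * matrix_norm (P \<xi>)))
      \<le> ereal (matrix_norm (matrix_inv P0) * matrix_norm P0)"
    by (rule SUP_least)
      (simp add: P_def condition_number_orthogonal_right[OF P0_inv R_orth])
  also have "\<dots> < \<infinity>" by simp
  finally show ?thesis using P_inv P_diag by (intro exI[of _ P]) simp
qed

end
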